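(* A standard system is complete if and only if it contains the system $\mathbf{Mp}$.
   Context: Formulas are built from literals, namely propositional variables $P,Q,\dots$ and their formal complements $\bar P,\bar Q,\dots$, using the binary connectives $\wedge$ and $\vee$. Negation $\neg$ is an operation on formulas, not a connective: $\neg P=\bar P$, $\neg\bar P=P$, $\neg(A\wedge B)=\neg A\vee\neg B$, $\neg(A\vee B)=\neg A\wedge\neg B$. A sequent is a nonempty finite multiset (disjoint union) of formulas. A comma denotes multiset union, and $\Gamma,\Delta,\Sigma$ range over possibly empty finite multisets of formulas. A formula is valid if it evaluates to $1$ under every $0/1$-assignment to its variables, with $\bar P$ read as the complement of $P$. Rules: - Axiom: infer $P,\neg P$ from no premises, for any propositional variable $P$. - $(\&)$: from $\Gamma,A$ and $\Gamma,B$ infer $\Gamma,A\wedge B$. - $(\otimes)$: from $\Delta,A$ and $\Sigma,B$ infer $\Delta,\Sigma,A\wedge B$. - Blended $(\wedge)$: from $\Gamma,\Delta,A$ and $\Gamma,\Sigma,B$ infer $\Gamma,\Delta,\Sigma,A\wedge B$. - $(\oplus)$: consists of both $(\oplus_1)$ and $(\oplus_2)$, where $(\oplus_i)$ infers $\Gamma,A_1\vee A_2$ from $\Gamma,A_i$. - $(\mathrm{par})$: from $\Gamma,A,B$ infer $\Gamma,A\vee B$. - Weakening $(\mathsf W)$: from $\Gamma$ infer $\Gamma,A$. - Contraction $(\mathsf C)$: from $\Gamma,A,A$ infer $\Gamma,A$. A system consists of the axiom together with a set of these rules. Derivations are finite trees of rule instances. A standard system is the axiom together with any subset of $\{(\&),(\otimes),(\oplus),(\mathrm{par}),(\mathsf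 W),(\mathsf C)\}$. The system $\mathbf{Mp}$ is the axiom together with $(\wedge),(\oplus),(\mathrm{par})$. A rule is derivable in a system $S$ if, for every instance of the rule, its conclusion can be derived in $S$ from its premises used as additional leaves. $S$ contains $T$ if every rule of $T$ is derivable in $S$. A system is complete if every valid formula, viewed as a one-element sequent, is derivable in it. *)

theory Defs
  imports "HOL-Library.Multiset"
begin

datatype 'a form =
    Pos 'a
  | Neg 'a
  | Conj "'a form" "'a form" (infixr "\<^bold>\<and>" 60)
  | Disj "'a form" "'a form" (infixr "\<^bold>\<or>" 55)

primrec neg :: "'a form \<Rightarrow> 'a form" where
  "neg (Pos p) = Neg p"
| "neg (Neg p) = Pos p"
| "neg (A \<^bold>\<and> B) = neg A \<^bold>\<or> neg B"
| "neg (A \<^bold>\<or> B) = neg A \<^bold>\<and> neg B"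

primrec eval :: "('a \<Rightarrow> bool) \<Rightarrow> 'a form \<Rightarrow> bool" where
  "eval v (Pos p) \<longleftrightarrow> v p"
| "eval v (Neg p) \<longleftrightarrow> \<not> v p"
| "eval v (A \<^bold>\<and> B) \<longleftrightarrow> eval v A \<and> eval v B"
| "eval v (A \<^bold>\<or> B) \<longleftrightarrow> eval v A \<or> eval v B"

definition valid :: "'a form \<Rightarrow> bool" where
  "valid A \<longleftrightarrow> (\<forall>v. eval v A)"

text \<open>
  Sequents are nonempty multisets. The type also contains the empty multiset, but in every
  rule below all premises and conclusions are nonempty; only for weakening does this need
  an explicit side condition.
\<close>

type_synonym 'a sequent = "'a form multiset"

text \<open>A rule is the set of its instances, each a list of premises with a conclusion.\<close>

type_synonym 'a rule = "('a sequent list \<times> 'a sequent) set"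

type_synonym 'a system = "'a rule set"

definition ax_rule :: "'a rule" where
  "ax_rule = {([], {#Pos p, neg (Pos p)#}) | p. True}"

definition with_rule :: "'a rule" where
  "with_rule = {([\<Gamma> + {#A#}, \<Gamma> + {#B#}], \<Gamma> + {#A \<^bold>\<and> B#}) | \<Gamma> A B. True}"

definition tensor_rule :: "'a rule" where
  "tensor_rule = {([\<Delta> + {#A#}, \<Sigma> + {#B#}], \<Delta> + \<Sigma> + {#A \<^bold>\<and> B#}) | \<Delta> \<Sigma> A B. True}"

definition blended_rule :: "'a rule" where
  "blended_rule =
     {([\<Gamma> + \<Delta> + {#A#}, \<Gamma> + \<Sigma> + {#B#}], \<Gamma> + \<Delta> + \<Sigma> + {#A \<^bold>\<and> B#}) | \<Gamma> \<Delta> \<Sigma> A B. True}"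

definition plus_rule :: "'a rule" where
  "plus_rule =
     {([\<Gamma> + {#A#}], \<Gamma> + {#A \<^bold>\<or> B#}) | \<Gamma> A B. True} \<union>
     {([\<Gamma> + {#B#}], \<Gamma> + {#A \<^bold>\<or> B#}) | \<Gamma> A B. True}"

definition par_rule :: "'a rule" where
  "par_rule = {([\<Gamma> + {#A, B#}], \<Gamma> + {#A \<^bold>\<or> B#}) | \<Gamma> A B. True}"

definition weakening_rule :: "'a rule" where
  "weakening_rule = {([\<Gamma>], \<Gamma> + {#A#}) | \<Gamma> A. \<Gamma> \<noteq> {#}}"

definition contraction_rule :: "'a rule" where
  "contraction_rule = {([\<Gamma> + {#A, A#}], \<Gamma> + {#A#}) | \<Gamma> A. True}"

text \<open>
  \<open>derives S H \<Gamma>\<close>: there is a finite derivation tree of \<open>\<Gamma>\<close> in \<open>S\<close> whose additional leaves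
  belong to \<open>H\<close>; a leaf may be used any number of times, including zero.
\<close>

inductive derives :: "'a system \<Rightarrow> 'a sequent set \<Rightarrow> 'a sequent \<Rightarrow> bool"
  for S :: "'a system" and H :: "'a sequent set" where
  leaf: "\<Gamma> \<in> H \<Longrightarrow> derives S H \<Gamma>"
| step: "R \<in> S \<Longrightarrow> (ps, \<Gamma>) \<in> R \<Longrightarrow> \<forall>p \<in> set ps. derives S H p \<Longrightarrow> derives S H \<Gamma>"

definition derivable_rule :: "'a system \<Rightarrow> 'a rule \<Rightarrow> bool" where
  "derivable_rule S R \<longleftrightarrow> (\<forall>(ps, \<Gamma>) \<in> R. derives S (set ps) \<Gamma>)"

definition contains_system :: "'a system \<Rightarrow> 'a system \<Rightarrow> bool" where
  "contains_system S T \<longleftrightarrow> (\<forall>R \<in> T. derivable_rule S R)"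

definition complete_system :: "'a system \<Rightarrow> bool" where
  "complete_system S \<longleftrightarrow> (\<forall>A. valid A \<longrightarrow> derives S {} {#A#})"

definition standard_system :: "'a system \<Rightarrow> bool" where
  "standard_system S \<longleftrightarrow>
     (\<exists>Rs \<subseteq> {with_rule, tensor_rule, plus_rule, par_rule, weakening_rule, contraction_rule}.
        S = insert ax_rule Rs)"

definition Mp :: "'a system" where
  "Mp = {ax_rule, blended_rule, plus_rule, par_rule}"

end

(* Completeness of Mp: by induction on size, Mp derives every valid sequent that has no valid
   proper subsequent. A minimal valid part of the premises of an invertible rule must contain
   all of the side formulas between them, and then one of the rules of Mp applies exactly.

   Conversely, a standard system in which some rule of Mp is missing and cannot be simulated
   lies below one of seven maximal standard systems. Each of these has an invariant of
   derivable sequents that is violated by some valid formula. *)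

theory Submission
  imports Defs
begin

section \<open>Derivation trees and invariants of derivable sequents\<close>

section \<open>Derivations\<close>

lemma derives_trans:
  assumes "derives S H \<Gamma>" "\<And>\<Delta>. \<Delta> \<in> H \<Longrightarrow> derives S K \<Delta>"
  shows "derives S K \<Gamma>"
  using assms by (induction rule: derives.induct) (auto intro: derives.step)

lemma derives_contains_system:
  assumes "contains_system S T" "derives T H \<Gamma>"
  shows "derives S H \<Gamma>"
  using assms(2)
proof (induction rule: derives.induct)
  case (step R ps \<Gamma>)
  then have "derives S (set ps) \<Gamma>"
    using assms(1) by (auto simp: contains_system_def derivable_rule_def)
  then show ?case
    using step.IH by (auto intro: derives_trans)
qed (rule derives.leaf)

text \<open>With no additional leaves, every sequent of the tree is the conclusion of a rule
  instance. The larger system \<open>T\<close> lets one check of \<open>I\<close> serve all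
  subsystems of a maximal system.\<close>

lemma derives_invariant:
  assumes "derives S {} \<Gamma>"
    and "S \<subseteq> T"
    and "\<And>R ps \<Delta>. R \<in> T \<Longrightarrow> (ps, \<Delta>) \<in> R \<Longrightarrow> \<forall>p \<in> set ps. I p \<Longrightarrow> I \<Delta>"
  shows "I \<Gamma>"
  using assms(1)
proof (induction rule: derives.induct)
  case (step R ps \<Gamma>)
  then show ?case
    using assms(2,3) by blast
qed simp

lemma not_completeI:
  assumes "valid A" "S \<subseteq> T"
    and "\<And>R ps \<Delta>. R \<in> T \<Longrightarrow> (ps, \<Delta>) \<in> R \<Longrightarrow> \<forall>p \<in> set ps. I p \<Longrightarrow> I \<Delta>"
    and "\<not> I {#A#}"
  shows "\<not> complete_system S"
proof
  assume "complete_system S"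
  then have "derives S {} {#A#}"
    using assms(1) by (simp add: complete_system_def)
  then have "I {#A#}"
    using assms(2,3) by (rule derives_invariant)
  then show False
    using assms(4) by simp
qed

section \<open>Closure of derivability under the single rules\<close>

lemmas rule_defs =
  ax_rule_def with_rule_def tensor_rule_def blended_rule_def plus_rule_def par_rule_def
  weakening_rule_def contraction_rule_def

lemma derives_ax:
  assumes "ax_rule \<in> S"
  shows "derives S H {#Pos p, Neg p#}"
proof -
  have "([], {#Pos p, neg (Pos p)#}) \<in> ax_rule"
    unfolding ax_rule_def by blast
  from derives.step[OF assms(1) this] show ?thesis
    by simp
qed

lemma derives_weakening:
  assumes "weakening_rule \<in> S" "derives S H \<Gamma>" "\<Gamma> \<noteq> {#}"
  shows "derives S H (\<Gamma> + \<Delta>)"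
proof (induction \<Delta>)
  case (add A \<Delta>)
  have "([\<Gamma> + \<Delta>], \<Gamma> + \<Delta> + {#A#}) \<in> weakening_rule"
    using assms(3) by (fastforce simp: weakening_rule_def)
  from derives.step[OF assms(1) this] add show ?case
    by simp
qed (use assms in simp)

lemma derives_contraction:
  assumes "contraction_rule \<in> S" "derives S H (\<Delta> + \<Gamma> + \<Gamma>)"
  shows "derives S H (\<Delta> + \<Gamma>)"
  using assms(2)
\<comment> \<open>\<open>\<Delta>\<close> must vary: the copy of \<open>A\<close> that survives a
  contraction joins it.\<close>
proof (induction \<Gamma> arbitrary: \<Delta>)
  case (add A \<Gamma>)
  have "([\<Delta> + \<Gamma> + \<Gamma> + {#A, A#}], \<Delta> + \<Gamma> + \<Gamma> + {#A#}) \<in> contraction_rule"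
    unfolding contraction_rule_def by blast
  from derives.step[OF assms(1) this] add.prems
  have "derives S H (\<Delta> + {#A#} + \<Gamma> + \<Gamma>)"
    by simp
  from add.IH[OF this] show ?case
    by simp
qed simp

lemma derives_with:
  assumes "with_rule \<in> S" "derives S H (\<Gamma> + {#A#})" "derives S H (\<Gamma> + {#B#})"
  shows "derives S H (\<Gamma> + {#A \<^bold>\<and> B#})"
proof -
  have "([\<Gamma> + {#A#}, \<Gamma> + {#B#}], \<Gamma> + {#A \<^bold>\<and> B#}) \<in> with_rule"
    unfolding with_rule_def by blast
  from derives.step[OF assms(1) this] assms(2,3) show ?thesis
    by simp
qed

lemma derives_tensor:
  assumes "tensor_rule \<in> S" "derives S H (\<Delta> + {#A#})" "derives S H (\<Sigma> + {#B#})"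
  shows "derives S H (\<Delta> + \<Sigma> + {#A \<^bold>\<and> B#})"
proof -
  have "([\<Delta> + {#A#}, \<Sigma> + {#B#}], \<Delta> + \<Sigma> + {#A \<^bold>\<and> B#}) \<in> tensor_rule"
    unfolding tensor_rule_def by blast
  from derives.step[OF assms(1) this] assms(2,3) show ?thesis
    by simp
qed

lemma derives_blended:
  assumes "blended_rule \<in> S" "derives S H (\<Gamma> + \<Delta> + {#A#})" "derives S H (\<Gamma> + \<Sigma> + {#B#})"
  shows "derives S H (\<Gamma> + \<Delta> + \<Sigma> + {#A \<^bold>\<and> B#})"
proof -
  have "([\<Gamma> + \<Delta> + {#A#}, \<Gamma> + \<Sigma> + {#B#}], \<Gamma> + \<Delta> + \<Sigma> + {#A \<^bold>\<and> B#}) \<in> blended_rule"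
    unfolding blended_rule_def by blast
  from derives.step[OF assms(1) this] assms(2,3) show ?thesis
    by simp
qed

lemma derives_plus1:
  assumes "plus_rule \<in> S" "derives S H (\<Gamma> + {#A#})"
  shows "derives S H (\<Gamma> + {#A \<^bold>\<or> B#})"
proof -
  have "([\<Gamma> + {#A#}], \<Gamma> + {#A \<^bold>\<or> B#}) \<in> plus_rule"
    unfolding plus_rule_def by blast
  from derives.step[OF assms(1) this] assms(2) show ?thesis
    by simp
qed

lemma derives_plus2:
  assumes "plus_rule \<in> S" "derives S H (\<Gamma> + {#B#})"
  shows "derives S H (\<Gamma> + {#A \<^bold>\<or> B#})"
proof -
  have "([\<Gamma> + {#B#}], \<Gamma> + {#A \<^bold>\<or> B#}) \<in> plus_rule"
    unfolding plus_rule_def by blast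
  from derives.step[OF assms(1) this] assms(2) show ?thesis
    by simp
qed

lemma derives_par:
  assumes "par_rule \<in> S" "derives S H (\<Gamma> + {#A, B#})"
  shows "derives S H (\<Gamma> + {#A \<^bold>\<or> B#})"
proof -
  have "([\<Gamma> + {#A, B#}], \<Gamma> + {#A \<^bold>\<or> B#}) \<in> par_rule"
    unfolding par_rule_def by blast
  from derives.step[OF assms(1) this] assms(2) show ?thesis
    by simp
qed

section \<open>Simulation of the rules of \<open>Mp\<close> by standard rules\<close>

lemma derivable_rule_member:
  "R \<in> S \<Longrightarrow> derivable_rule S R"
  by (auto simp: derivable_rule_def intro: derives.step derives.leaf)

text \<open>Weakening brings both premises to the common context \<Gamma>, \<Delta>,
  \<Sigma>.\<close>

lemma derivable_blended_with_weakening: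
  assumes "with_rule \<in> S" "weakening_rule \<in> S"
  shows "derivable_rule S blended_rule"
proof -
  have "derives S {\<Gamma> + \<Delta> + {#A#}, \<Gamma> + \<Sigma> + {#B#}} (\<Gamma> + \<Delta> + \<Sigma> + {#A \<^bold>\<and> B#})" for \<Gamma> \<Delta> \<Sigma> A B
  proof (rule derives_with[OF assms(1)])
    show "derives S {\<Gamma> + \<Delta> + {#A#}, \<Gamma> + \<Sigma> + {#B#}} (\<Gamma> + \<Delta> + \<Sigma> + {#A#})"
      using derives_weakening[OF assms(2) derives.leaf, of "\<Gamma> + \<Delta> + {#A#}" _ \<Sigma>]
      by (simp add: ac_simps)
    show "derives S {\<Gamma> + \<Delta> + {#A#}, \<Gamma> + \<Sigma> + {#B#}} (\<Gamma> + \<Delta> + \<Sigma> + {#B#})"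
      using derives_weakening[OF assms(2) derives.leaf, of "\<Gamma> + \<Sigma> + {#B#}" _ \<Delta>]
      by (simp add: ac_simps)
  qed
  then show ?thesis
    by (auto simp: derivable_rule_def blended_rule_def)
qed

text \<open>Tensor leaves two copies of the shared context \<Gamma>, which contraction
  merges.\<close>

lemma derivable_blended_tensor_contraction:
  assumes "tensor_rule \<in> S" "contraction_rule \<in> S"
  shows "derivable_rule S blended_rule"
proof -
  have "derives S {\<Gamma> + \<Delta> + {#A#}, \<Gamma> + \<Sigma> + {#B#}} (\<Gamma> + \<Delta> + \<Sigma> + {#A \<^bold>\<and> B#})" for \<Gamma> \<Delta> \<Sigma> A B
  proof -
    let ?H = "{\<Gamma> + \<Delta> + {#A#}, \<Gamma> + \<Sigma> + {#B#}}"
    have "derives S ?H ((\<Gamma> + \<Delta>) + (\<Gamma> + \<Sigma>) + {#A \<^bold>\<and> B#})"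
      by (rule derives_tensor[OF assms(1)]) (auto intro: derives.leaf)
    then have "derives S ?H ((\<Delta> + \<Sigma> + {#A \<^bold>\<and> B#}) + \<Gamma> + \<Gamma>)"
      by (simp add: ac_simps)
    from derives_contraction[OF assms(2) this] show ?thesis
      by (simp add: ac_simps)
  qed
  then show ?thesis
    by (auto simp: derivable_rule_def blended_rule_def)
qed

text \<open>Weakening supplies the absent disjunct before par is applied.\<close>

lemma derivable_plus_par_weakening:
  assumes "par_rule \<in> S" "weakening_rule \<in> S"
  shows "derivable_rule S plus_rule"
proof -
  have "derives S {\<Gamma> + {#A#}} (\<Gamma> + {#A, B#})" for \<Gamma> A B
    using derives_weakening[OF assms(2) derives.leaf, of "\<Gamma> + {#A#}" _ "{#B#}"]
    by (simp add: add_mset_commute)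
  moreover have "derives S {\<Gamma> + {#B#}} (\<Gamma> + {#A, B#})" for \<Gamma> A B
    using derives_weakening[OF assms(2) derives.leaf, of "\<Gamma> + {#B#}" _ "{#A#}"] by simp
  ultimately have "derives S {\<Gamma> + {#A#}} (\<Gamma> + {#A \<^bold>\<or> B#})"
      "derives S {\<Gamma> + {#B#}} (\<Gamma> + {#A \<^bold>\<or> B#})" for \<Gamma> A B
    using derives_par[OF assms(1)] by blast+
  then show ?thesis
    by (auto simp: derivable_rule_def plus_rule_def)
qed

text \<open>Plus turns \<open>B\<close> and then \<open>A\<close> into a copy of the disjunction
  each; contraction merges the copies.\<close>

lemma derivable_par_plus_contraction:
  assumes "plus_rule \<in> S" "contraction_rule \<in> S"
  shows "derivable_rule S par_rule"
proof -
  have "derives S {\<Gamma> + {#A, B#}} (\<Gamma> + {#A \<^bold>\<or> B#})" for \<Gamma> A B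
  proof -
    let ?H = "{\<Gamma> + {#A, B#}}"
    have "derives S ?H ((\<Gamma> + {#A#}) + {#A \<^bold>\<or> B#})"
      by (rule derives_plus2[OF assms(1)]) (auto intro: derives.leaf simp: add_mset_commute)
    then have "derives S ?H ((\<Gamma> + {#A \<^bold>\<or> B#}) + {#A#})"
      by (simp add: add_mset_commute)
    from derives_plus1[OF assms(1) this, of B]
    show ?thesis
      by (rule derives_contraction[OF assms(2)])
  qed
  then show ?thesis
    by (auto simp: derivable_rule_def par_rule_def)
qed

section \<open>Minimal valid sequents and their derivations in \<open>Mp\<close>\<close>

section \<open>Completeness of Mp\<close>

definition valid_sequent :: "'a sequent \<Rightarrow> bool" where
  "valid_sequent \<Gamma> \<longleftrightarrow> (\<forall>v. \<exists>A \<in># \<Gamma>. eval v A)"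

text \<open>Validity depends only on which formulas occur, so minimality among submultisets also
  excludes repeated formulas.\<close>

definition minimal_valid :: "'a sequent \<Rightarrow> bool" where
  "minimal_valid \<Gamma> \<longleftrightarrow> valid_sequent \<Gamma> \<and> (\<forall>\<Delta>. \<Delta> \<subseteq># \<Gamma> \<longrightarrow> valid_sequent \<Delta> \<longrightarrow> \<Delta> = \<Gamma>)"

lemma valid_sequent_singleton: "valid_sequent {#A#} \<longleftrightarrow> valid A"
  by (simp add: valid_sequent_def valid_def)

lemma valid_sequent_mono: "valid_sequent \<Gamma> \<Longrightarrow> set_mset \<Gamma> \<subseteq> set_mset \<Delta> \<Longrightarrow> valid_sequent \<Delta>"
  unfolding valid_sequent_def by blast

lemma minimal_valid_exists:
  assumes "valid_sequent \<Gamma>"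
  obtains \<Delta> where "\<Delta> \<subseteq># \<Gamma>" "minimal_valid \<Delta>"
  using assms
proof (induction "size \<Gamma>" arbitrary: \<Gamma> thesis rule: less_induct)
  case less
  show ?case
  proof (cases "minimal_valid \<Gamma>")
    case False
    then obtain \<Delta> where \<Delta>: "\<Delta> \<subset># \<Gamma>" "valid_sequent \<Delta>"
      using less.prems(2) by (auto simp: minimal_valid_def subset_mset_def)
    from less.hyps[OF mset_subset_size[OF \<Delta>(1)] _ \<Delta>(2)] obtain \<Theta>
      where "\<Theta> \<subseteq># \<Delta>" "minimal_valid \<Theta>"
      by blast
    then show ?thesis
      using less.prems(1) \<Delta>(1) by (meson subset_mset.less_imp_le subset_mset.order_trans)
  qed (use less.prems in auto)
qed

text \<open>Induction measure: a compound formula outweighs its two immediate subformulas together,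
  so even the premise of par is lighter than its conclusion.\<close>

definition weight :: "'a sequent \<Rightarrow> nat" where
  "weight \<Gamma> = (\<Sum>A \<in># \<Gamma>. size A)"

lemma weight_simps [simp]:
  "weight {#} = 0" "weight (add_mset A \<Gamma>) = size A + weight \<Gamma>"
  "weight (\<Gamma> + \<Delta>) = weight \<Gamma> + weight \<Delta>"
  by (simp_all add: weight_def)

lemma weight_mono: "\<Gamma> \<subseteq># \<Delta> \<Longrightarrow> weight \<Gamma> \<le> weight \<Delta>"
  by (auto simp: mset_subset_eq_exists_conv)

text \<open>Falsify \<open>\<Gamma>\<close> by making \<open>p\<close> true exactly when \<open>Neg p\<close> occurs.\<close>

lemma valid_literals:
  assumes "valid_sequent \<Gamma>" "\<And>A. A \<in># \<Gamma> \<Longrightarrow> (\<exists>p. A = Pos p \<or> A = Neg p)"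
  obtains p where "Pos p \<in># \<Gamma>" "Neg p \<in># \<Gamma>"
proof -
  obtain A where "A \<in># \<Gamma>" "eval (\<lambda>p. Neg p \<in># \<Gamma>) A"
    using assms(1) unfolding valid_sequent_def by blast
  then show thesis
    using assms(2)[of A] that by auto
qed

lemma Mp_rules: "ax_rule \<in> Mp" "blended_rule \<in> Mp" "plus_rule \<in> Mp" "par_rule \<in> Mp"
  by (simp_all add: Mp_def)

lemma subset_add_cases:
  assumes "\<Theta> \<subseteq># add_mset A \<Gamma>"
  obtains "\<Theta> \<subseteq># \<Gamma>" | \<Delta> where "\<Theta> = add_mset A \<Delta>" "\<Delta> \<subseteq># \<Gamma>"
proof (cases "A \<in># \<Theta>")
  case True
  then obtain \<Delta> where "\<Theta> = add_mset A \<Delta>"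
    using multi_member_split by metis
  then show thesis
    using assms that by simp
next
  case False
  then have "\<Theta> \<subseteq># \<Gamma>"
    using assms by (metis diff_single_trivial subset_eq_diff_conv add_mset_add_single)
  then show thesis
    by (rule that)
qed

lemma minimal_validD:
  "minimal_valid \<Gamma> \<Longrightarrow> \<Delta> \<subseteq># \<Gamma> \<Longrightarrow> valid_sequent \<Delta> \<Longrightarrow> \<Delta> = \<Gamma>"
  by (simp add: minimal_valid_def)

text \<open>A minimal valid part of the premise cannot lie within \<open>\<Gamma>\<close>, since it
  would then be a valid proper part of the conclusion. Hence it retains the active formula
  \<open>A\<close>.\<close>

lemma minimal_valid_premise:
  assumes "minimal_valid (add_mset C \<Gamma>)" "valid_sequent (add_mset A \<Gamma>)"
  obtains \<Delta> where "\<Delta> \<subseteq># \<Gamma>" "minimal_valid (add_mset A \<Delta>)"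
proof -
  obtain \<Theta> where \<Theta>: "\<Theta> \<subseteq># add_mset A \<Gamma>" "minimal_valid \<Theta>"
    using assms(2) by (rule minimal_valid_exists)
  from \<Theta>(1) show thesis
  proof (cases rule: subset_add_cases)
    case 1
    then have "\<Theta> \<subseteq># add_mset C \<Gamma>"
      by (metis add_mset_add_single mset_subset_eq_add_left subset_mset.order_trans)
    then have "\<Theta> = add_mset C \<Gamma>"
      using \<Theta>(2) assms(1) by (auto simp: minimal_valid_def)
    then show thesis
      using 1 by (metis add_mset_add_single mset_subset_eq_add_left multi_self_add_other_not_self
          subset_mset.order_antisym)
  qed (use \<Theta>(2) that in auto)
qed

lemma Mp_derives_minimal_valid:
  "minimal_valid \<Gamma> \<Longrightarrow> derives Mp {} \<Gamma>"
proof (induction "weight \<Gamma>" arbitrary: \<Gamma> rule: less_induct)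
  case less
  have val: "valid_sequent \<Gamma>"
    using less.prems by (simp add: minimal_valid_def)
  have "(\<exists>p. C = Pos p \<or> C = Neg p) \<or> (\<exists>A B. C = A \<^bold>\<and> B) \<or> (\<exists>A B. C = A \<^bold>\<or> B)" for C :: "'a form"
    by (cases C) auto
  then consider (lit) "\<And>A. A \<in># \<Gamma> \<Longrightarrow> (\<exists>p. A = Pos p \<or> A = Neg p)"
    | (conj) A B where "A \<^bold>\<and> B \<in># \<Gamma>"
    | (disj) A B where "A \<^bold>\<or> B \<in># \<Gamma>"
    by blast
  then show ?case
  proof cases
    case lit
    with val obtain p where p: "Pos p \<in># \<Gamma>" "Neg p \<in># \<Gamma>"
      by (rule valid_literals)
    \<comment> \<open>A complementary pair is valid by itself, so minimality leaves nothing
      else.\<close>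
    have "{#Pos p, Neg p#} \<subseteq># \<Gamma>"
      using p by (simp add: insert_subset_eq_iff in_diff_count)
    moreover have "valid_sequent {#Pos p, Neg p#}"
      by (simp add: valid_sequent_def)
    ultimately have "\<Gamma> = {#Pos p, Neg p#}"
      using less.prems by (metis minimal_validD)
    then show ?thesis
      using derives_ax[OF Mp_rules(1)] by simp
  next
    case conj
    from multi_member_split[OF this] obtain \<Gamma>' where \<Gamma>: "\<Gamma> = add_mset (A \<^bold>\<and> B) \<Gamma>'"
      by blast
    note min = less.prems[unfolded \<Gamma>]
    have "valid_sequent (add_mset A \<Gamma>')" "valid_sequent (add_mset B \<Gamma>')"
      using val unfolding \<Gamma> valid_sequent_def by auto
    then obtain \<Delta> \<Sigma> where \<Delta>: "\<Delta> \<subseteq># \<Gamma>'" "minimal_valid (add_mset A \<Delta>)"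
      and \<Sigma>: "\<Sigma> \<subseteq># \<Gamma>'" "minimal_valid (add_mset B \<Sigma>)"
      using minimal_valid_premise[OF min] by metis
    \<comment> \<open>An assignment falsifying both \<open>\<Delta>\<close> and
      \<open>\<Sigma>\<close> satisfies \<open>A\<close> and \<open>B\<close>. Minimality then makes
      the union the whole context.\<close>
    have "valid_sequent (add_mset (A \<^bold>\<and> B) (\<Delta> \<union># \<Sigma>))"
      unfolding valid_sequent_def
    proof
      fix v
      show "\<exists>C\<in>#add_mset (A \<^bold>\<and> B) (\<Delta> \<union># \<Sigma>). eval v C"
        using \<Delta>(2) \<Sigma>(2) unfolding minimal_valid_def valid_sequent_def by fastforce
    qed
    then have "add_mset (A \<^bold>\<and> B) (\<Delta> \<union># \<Sigma>) = add_mset (A \<^bold>\<and> B) \<Gamma>'"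
      using \<Delta>(1) \<Sigma>(1) by (intro minimal_validD[OF min]) simp_all
    then have "\<Gamma>' = \<Delta> \<union># \<Sigma>"
      by simp
    \<comment> \<open>The shared part and the two private parts are the three contexts of the
      blended rule.\<close>
    moreover have "\<Delta> \<union># \<Sigma> = \<Delta> \<inter># \<Sigma> + (\<Delta> - \<Sigma>) + (\<Sigma> - \<Delta>)"
      by (rule multiset_eqI; simp add: max_def min_def)+
    ultimately have "\<Gamma> = \<Delta> \<inter># \<Sigma> + (\<Delta> - \<Sigma>) + (\<Sigma> - \<Delta>) + {#A \<^bold>\<and> B#}"
      by (simp add: \<Gamma>)
    moreover have "weight (add_mset A \<Delta>) < weight \<Gamma>" "weight (add_mset B \<Sigma>) < weight \<Gamma>"
      using weight_mono[OF \<Delta>(1)] weight_mono[OF \<Sigma>(1)] by (simp_all add: \<Gamma>)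
    then have "derives Mp {} (add_mset A \<Delta>)" "derives Mp {} (add_mset B \<Sigma>)"
      using less.hyps \<Delta>(2) \<Sigma>(2) by blast+
    moreover have "\<Delta> \<inter># \<Sigma> + (\<Delta> - \<Sigma>) = \<Delta>" "\<Delta> \<inter># \<Sigma> + (\<Sigma> - \<Delta>) = \<Sigma>"
      by (rule multiset_eqI; simp add: max_def min_def)+
    ultimately show ?thesis
      using derives_blended[OF Mp_rules(2), of "{}" "\<Delta> \<inter># \<Sigma>" "\<Delta> - \<Sigma>" A "\<Sigma> - \<Delta>" B]
      by simp
  next
    case disj
    from multi_member_split[OF this] obtain \<Gamma>' where \<Gamma>: "\<Gamma> = add_mset (A \<^bold>\<or> B) \<Gamma>'"
      by blast
    note min = less.prems[unfolded \<Gamma>]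
    \<comment> \<open>The disjunction is true whenever a member of \<open>\<Theta>\<close> is, so it
      can replace \<open>\<Theta>\<close>; minimality of the conclusion then forces the full
      context.\<close>
    have full: "\<Delta> = \<Gamma>'"
      if "\<Delta> \<subseteq># \<Gamma>'" "\<Theta> \<subseteq># {#A, B#}" "valid_sequent (\<Delta> + \<Theta>)" for \<Delta> \<Theta>
    proof -
      have "set_mset \<Theta> \<subseteq> {A, B}"
        using set_mset_mono[OF that(2)] by simp
      then have "valid_sequent (add_mset (A \<^bold>\<or> B) \<Delta>)"
        using that(3) unfolding valid_sequent_def by fastforce
      then have "add_mset (A \<^bold>\<or> B) \<Delta> = add_mset (A \<^bold>\<or> B) \<Gamma>'"
        using that(1) by (intro minimal_validD[OF min]) simp_all
      then show ?thesis
        by simp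
    qed
    show ?thesis
    \<comment> \<open>If one disjunct suffices beside the context, a plus rule applies; if neither
      does, both are needed and par applies.\<close>
    proof (cases "valid_sequent (add_mset A \<Gamma>')")
      case True
      then obtain \<Delta> where \<Delta>: "\<Delta> \<subseteq># \<Gamma>'" "minimal_valid (add_mset A \<Delta>)"
        using minimal_valid_premise[OF min] by metis
      then have "\<Delta> = \<Gamma>'"
        using full[of \<Delta> "{#A#}"] by (simp add: minimal_valid_def)
      then have "derives Mp {} (\<Gamma>' + {#A#})"
        using \<Delta>(2) less.hyps[of "add_mset A \<Delta>"] by (simp add: \<Gamma>)
      from derives_plus1[OF Mp_rules(3) this] show ?thesis
        by (simp add: \<Gamma>)
    next
      case notA: False
      show ?thesis
      proof (cases "valid_sequent (add_mset B \<Gamma>')")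
        case True
        then obtain \<Delta> where \<Delta>: "\<Delta> \<subseteq># \<Gamma>'" "minimal_valid (add_mset B \<Delta>)"
          using minimal_valid_premise[OF min] by metis
        then have "\<Delta> = \<Gamma>'"
          using full[of \<Delta> "{#B#}"] by (simp add: minimal_valid_def)
        then have "derives Mp {} (\<Gamma>' + {#B#})"
          using \<Delta>(2) less.hyps[of "add_mset B \<Delta>"] by (simp add: \<Gamma>)
        from derives_plus2[OF Mp_rules(3) this] show ?thesis
          by (simp add: \<Gamma>)
      next
        case notB: False
        have "valid_sequent (add_mset A (add_mset B \<Gamma>'))"
          using val unfolding \<Gamma> valid_sequent_def by auto
        then obtain \<Theta> where \<Theta>: "\<Theta> \<subseteq># add_mset A (add_mset B \<Gamma>')" "minimal_valid \<Theta>"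
          by (rule minimal_valid_exists)
        have val\<Theta>: "valid_sequent \<Theta>"
          using \<Theta>(2) by (simp add: minimal_valid_def)
        \<comment> \<open>Otherwise \<open>\<Theta>\<close> would be a part of \<open>B\<close> with
          the context, which is not valid. The same argument with \<open>A\<close> then yields
          \<open>B\<close>.\<close>
        from \<Theta>(1) obtain \<Lambda> where \<Lambda>: "\<Theta> = add_mset A \<Lambda>" "\<Lambda> \<subseteq># add_mset B \<Gamma>'"
        proof (cases rule: subset_add_cases)
          case 1
          then show ?thesis
            using notB val\<Theta> by (meson set_mset_mono valid_sequent_mono)
        qed
        from \<Lambda>(2) obtain \<Delta> where \<Delta>: "\<Lambda> = add_mset B \<Delta>" "\<Delta> \<subseteq># \<Gamma>'"
        proof (cases rule: subset_add_cases)
          case 1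
          then have "set_mset \<Theta> \<subseteq> set_mset (add_mset A \<Gamma>')"
            using set_mset_mono[OF 1] by (auto simp: \<Lambda>(1))
          then show ?thesis
            using notA val\<Theta> valid_sequent_mono by blast
        qed
        have "\<Delta> = \<Gamma>'"
          using full[OF \<Delta>(2), of "{#A, B#}"] val\<Theta> by (simp add: \<Lambda>(1) \<Delta>(1))
        then have "derives Mp {} (\<Gamma>' + {#A, B#})"
          using \<Theta>(2) less.hyps[of \<Theta>] by (simp add: \<Gamma> \<Lambda>(1) \<Delta>(1))
        from derives_par[OF Mp_rules(4) this] show ?thesis
          by (simp add: \<Gamma>)
      qed
    qed
  qed
qed

text \<open>A valid singleton is minimal, because the empty sequent is not valid.\<close>

lemma complete_Mp: "complete_system Mp"
  unfolding complete_system_def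
proof (intro allI impI)
  fix A :: "'a form"
  assume "valid A"
  then have "valid_sequent {#A#}"
    by (simp add: valid_sequent_singleton)
  then obtain \<Delta> where \<Delta>: "\<Delta> \<subseteq># {#A#}" "minimal_valid \<Delta>"
    by (rule minimal_valid_exists)
  moreover have "\<Delta> \<noteq> {#}"
    using \<Delta>(2) by (auto simp: minimal_valid_def valid_sequent_def)
  ultimately have "\<Delta> = {#A#}"
    by (auto elim: subset_add_cases)
  then show "derives Mp {} {#A#}"
    using \<Delta>(2) Mp_derives_minimal_valid by blast
qed

section \<open>Invariants refuting completeness of the seven maximal systems\<close>

section \<open>Incomplete systems\<close>

text \<open>Axiom, plus, par, weakening and contraction are sound however conjunctions are
  read.\<close>

primrec eval_no_conj :: "('a \<Rightarrow> bool) \<Rightarrow> 'a form \<Rightarrow> bool" where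
  "eval_no_conj v (Pos p) \<longleftrightarrow> v p"
| "eval_no_conj v (Neg p) \<longleftrightarrow> \<not> v p"
| "eval_no_conj v (A \<^bold>\<and> B) \<longleftrightarrow> False"
| "eval_no_conj v (A \<^bold>\<or> B) \<longleftrightarrow> eval_no_conj v A \<or> eval_no_conj v B"

lemma incomplete_no_with_no_tensor:
  assumes "S \<subseteq> {ax_rule, plus_rule, par_rule, weakening_rule, contraction_rule}"
  shows "\<not> complete_system S"
proof -
  fix p :: 'a and v :: "'a \<Rightarrow> bool"
  let ?T = "Pos p \<^bold>\<or> Neg p"
  show ?thesis
    by (rule not_completeI[OF _ assms, where A = "?T \<^bold>\<and> ?T"
          and I = "\<lambda>\<Gamma>. \<exists>A \<in># \<Gamma>. eval_no_conj v A"])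
      (auto simp: valid_def rule_defs)
qed

text \<open>The dual reading: the rules other than plus and par are sound however disjunctions are
  read.\<close>

primrec eval_no_disj :: "('a \<Rightarrow> bool) \<Rightarrow> 'a form \<Rightarrow> bool" where
  "eval_no_disj v (Pos p) \<longleftrightarrow> v p"
| "eval_no_disj v (Neg p) \<longleftrightarrow> \<not> v p"
| "eval_no_disj v (A \<^bold>\<and> B) \<longleftrightarrow> eval_no_disj v A \<and> eval_no_disj v B"
| "eval_no_disj v (A \<^bold>\<or> B) \<longleftrightarrow> False"

lemma incomplete_no_plus_no_par:
  assumes "S \<subseteq> {ax_rule, with_rule, tensor_rule, weakening_rule, contraction_rule}"
  shows "\<not> complete_system S"
proof -
  fix p :: 'a and v :: "'a \<Rightarrow> bool"
  show ?thesis
    by (rule not_completeI[OF _ assms, where A = "Pos p \<^bold>\<or> Neg p"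
          and I = "\<lambda>\<Gamma>. \<exists>A \<in># \<Gamma>. eval_no_disj v A"])
      (auto simp: valid_def rule_defs)
qed

text \<open>Axioms have two formulas, and only par and contraction have a conclusion shorter than a
  premise.\<close>

lemma incomplete_no_par_no_contraction:
  assumes "S \<subseteq> {ax_rule, with_rule, tensor_rule, plus_rule, weakening_rule}"
  shows "\<not> complete_system S"
proof -
  fix p :: 'a
  show ?thesis
    by (rule not_completeI[OF _ assms, where A = "Pos p \<^bold>\<or> Neg p" and I = "\<lambda>\<Gamma>. size \<Gamma> \<ge> 2"])
      (auto simp: valid_def rule_defs)
qed

text \<open>
  Three-valued Lukasiewicz logic, with the values \<open>0, 1/2, 1\<close> doubled and all literals at \<open>1/2\<close>.
  The subtraction is meant to be truncated.
\<close>

primrec luk :: "'a form \<Rightarrow> nat" where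
  "luk (Pos p) = 1"
| "luk (Neg p) = 1"
| "luk (A \<^bold>\<and> B) = luk A + luk B - 2"
| "luk (A \<^bold>\<or> B) = min 2 (luk A + luk B)"

text \<open>The comma is read as strong disjunction, so a sequent has value 1 when its doubled
  values sum to at least 2. The conjunction in the witness has value 0, leaving a total of
  1.\<close>

lemma incomplete_no_with_no_contraction:
  assumes "S \<subseteq> {ax_rule, tensor_rule, plus_rule, par_rule, weakening_rule}"
  shows "\<not> complete_system S"
proof -
  fix p :: 'a
  show ?thesis
    by (rule not_completeI[OF _ assms, where A = "Pos p \<^bold>\<or> (Neg p \<^bold>\<and> Neg p)"
          and I = "\<lambda>\<Gamma>. (\<Sum>A \<in># \<Gamma>. luk A) \<ge> 2"])
      (auto simp: valid_def rule_defs)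
qed

text \<open>
  The three-element Sugihara algebra, with strong conjunction and disjunction; \<open>0\<close> and \<open>1\<close> are
  the designated values.
\<close>

primrec sug :: "'a \<Rightarrow> 'a form \<Rightarrow> int" where
  "sug p (Pos q) = (if q = p then -1 else 0)"
| "sug p (Neg q) = (if q = p then 1 else 0)"
| "sug p (A \<^bold>\<and> B) = (if sug p A = -1 \<or> sug p B = -1 then -1 else max (sug p A) (sug p B))"
| "sug p (A \<^bold>\<or> B) = (if sug p A = 1 \<or> sug p B = 1 then 1 else min (sug p A) (sug p B))"

text \<open>Says that the iterated strong disjunction of a sequent with values \<open>X\<close> is
  designated. A set suffices because this disjunction is idempotent.\<close>

definition designated :: "int set \<Rightarrow> bool" where
  "designated X \<longleftrightarrow> 1 \<in> X \<or> X \<subseteq> {0}"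

text \<open>Serves both conjunction rules: \<open>X\<close> and \<open>Y\<close> are the values of
  the two contexts, which coincide for \<open>with_rule\<close>.\<close>

lemma designated_conj:
  assumes "designated (insert (sug p A) X)" "designated (insert (sug p B) Y)"
  shows "designated (insert (sug p (A \<^bold>\<and> B)) (X \<union> Y))"
  using assms by (auto simp: designated_def)

lemma designated_disj:
  assumes "designated (insert (sug p A) (insert (sug p B) X))"
  shows "designated (insert (sug p (A \<^bold>\<or> B)) X)"
  using assms by (auto simp: designated_def)

text \<open>The tautology in \<open>q\<close> has value 0, and the irrelevant disjunct
  \<open>Pos p\<close> drags the witness down to -1.\<close>

lemma incomplete_no_plus_no_weakening:
  fixes p q :: 'a
  assumes "p \<noteq> q" and S: "S \<subseteq> {ax_rule, with_rule, tensor_rule, par_rule, contraction_rule}"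
  shows "\<not> complete_system (S :: 'a system)"
proof (rule not_completeI[OF _ S, where A = "Pos p \<^bold>\<or> (Pos q \<^bold>\<or> Neg q)"
      and I = "\<lambda>\<Gamma>. designated (sug p ` set_mset \<Gamma>)"])
  fix R :: "'a rule" and ps \<Delta>
  assume R: "R \<in> {ax_rule, with_rule, tensor_rule, par_rule, contraction_rule}" "(ps, \<Delta>) \<in> R"
    and ps: "\<forall>\<Gamma> \<in> set ps. designated (sug p ` set_mset \<Gamma>)"
  from R(1) consider "R = ax_rule" | "R = with_rule" | "R = tensor_rule" | "R = par_rule"
    | "R = contraction_rule"
    by blast
  then show "designated (sug p ` set_mset \<Delta>)"
  proof cases
    case 1
    then show ?thesis
      using R(2) by (auto simp: ax_rule_def designated_def)
  next
    case 2
    then show ?thesis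
      using R(2) ps designated_conj[of p _ X _ X for X]
      by (auto simp: with_rule_def simp del: sug.simps)
  next
    case 3
    then show ?thesis
      using R(2) ps by (auto simp: tensor_rule_def image_Un designated_conj simp del: sug.simps)
  next
    case 4
    then show ?thesis
      using R(2) ps by (auto simp: par_rule_def designated_disj simp del: sug.simps)
  next
    case 5
    then show ?thesis
      using R(2) ps by (auto simp: contraction_rule_def)
  qed
qed (use assms(1) in \<open>auto simp: valid_def designated_def\<close>)

datatype colour = Lp | Ln | Lq | Bad | Top

text \<open>The mixed case of \<open>Lp\<close> and \<open>Ln\<close> may return either: if both
  premises are good, the context has both colours or contains \<open>Top\<close>.\<close>

fun colour_conj :: "colour \<Rightarrow> colour \<Rightarrow> colour" where
  "colour_conj Top b = b"
| "colour_conj a Top = a"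
| "colour_conj Lp Ln = Lp"
| "colour_conj Ln Lp = Lp"
| "colour_conj a b = (if a = b then a else Bad)"

text \<open>\<open>Bad\<close> can be neutral because a sequent containing it is good only through
  \<open>Top\<close>.\<close>

fun colour_disj :: "colour \<Rightarrow> colour \<Rightarrow> colour" where
  "colour_disj Bad b = b"
| "colour_disj a Bad = a"
| "colour_disj a b = (if a = b then a else Top)"

primrec colour_of :: "'a \<Rightarrow> 'a form \<Rightarrow> colour" where
  "colour_of p (Pos q) = (if q = p then Lp else Lq)"
| "colour_of p (Neg q) = (if q = p then Ln else Lq)"
| "colour_of p (A \<^bold>\<and> B) = colour_conj (colour_of p A) (colour_of p B)"
| "colour_of p (A \<^bold>\<or> B) = colour_disj (colour_of p A) (colour_of p B)"

text \<open>
  Without \<open>\<otimes>\<close> and weakening, \<open>p\<close>-literals and other literals never meet in a derivable sequent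
  of literals. \<open>Bad\<close> marks conjunctions that would need them to, \<open>Top\<close> any formula about which
  nothing is claimed.
\<close>

definition good_colours :: "colour set \<Rightarrow> bool" where
  "good_colours X \<longleftrightarrow> Top \<in> X \<or> X = {Lq} \<or> X = {Lp, Ln}"

lemma good_colours_conj:
  "good_colours (insert a X) \<Longrightarrow> good_colours (insert b X) \<Longrightarrow> good_colours (insert (colour_conj a b) X)"
  by (cases a; cases b) (auto simp: good_colours_def)

text \<open>The three alternatives are the premises of the two plus rules and of par.\<close>

lemma good_colours_disj:
  "good_colours (insert a X) \<or> good_colours (insert b X) \<or> good_colours (insert a (insert b X)) \<Longrightarrow>
     good_colours (insert (colour_disj a b) X)"
  by (cases a; cases b) (auto simp: good_colours_def)

text \<open>The conjunction in the witness mixes \<open>Ln\<close> with \<open>Lq\<close> and is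
  \<open>Bad\<close>, so the whole formula has colour \<open>Lp\<close>, and \<open>{Lp}\<close> is
  not good.\<close>

lemma incomplete_no_tensor_no_weakening:
  fixes p q :: 'a
  assumes "p \<noteq> q" and S: "S \<subseteq> {ax_rule, with_rule, plus_rule, par_rule, contraction_rule}"
  shows "\<not> complete_system (S :: 'a system)"
proof (rule not_completeI[OF _ S, where A = "Pos p \<^bold>\<or> (Neg p \<^bold>\<and> (Pos q \<^bold>\<or> Neg q))"
      and I = "\<lambda>\<Gamma>. good_colours (colour_of p ` set_mset \<Gamma>)"])
  fix R :: "'a rule" and ps \<Delta>
  assume R: "R \<in> {ax_rule, with_rule, plus_rule, par_rule, contraction_rule}" "(ps, \<Delta>) \<in> R"
    and ps: "\<forall>\<Gamma> \<in> set ps. good_colours (colour_of p ` set_mset \<Gamma>)"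
  from R(1) consider "R = ax_rule" | "R = with_rule" | "R = plus_rule" | "R = par_rule"
    | "R = contraction_rule"
    by blast
  then show "good_colours (colour_of p ` set_mset \<Delta>)"
  proof cases
    case 1
    then show ?thesis
      using R(2) by (auto simp: ax_rule_def good_colours_def)
  next
    case 2
    then show ?thesis
      using R(2) ps by (auto simp: with_rule_def good_colours_conj)
  next
    case 3
    then show ?thesis
      using R(2) ps by (auto simp: plus_rule_def good_colours_disj)
  next
    case 4
    then show ?thesis
      using R(2) ps by (auto simp: par_rule_def good_colours_disj)
  next
    case 5
    then show ?thesis
      using R(2) ps by (auto simp: contraction_rule_def)
  qed
qed (use assms(1) in \<open>auto simp: valid_def good_colours_def\<close>)

text \<open>
  The innermost sequent \<open>p, q, (\<not>p \<and> \<not>q) \<and> \<not>p\<close> needs \<open>p\<close> shared and \<open>q\<close> split.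
\<close>

lemma incomplete_no_weakening_no_contraction:
  fixes p q :: 'a
  assumes "p \<noteq> q" and S: "S \<subseteq> {ax_rule, with_rule, tensor_rule, plus_rule, par_rule}"
  shows "\<not> complete_system (S :: 'a system)"
proof -
  define X where "X = Neg p \<^bold>\<and> Neg q"
  define Y where "Y = X \<^bold>\<and> Neg p"
  define Z where "Z = Pos q \<^bold>\<or> Y"
  define F where "F = Pos p \<^bold>\<or> Z"
  \<comment> \<open>Validity disposes of most backward steps; the four excluded sequents are the
    valid ones reached by searching backwards from \<open>F\<close> until a dead end.\<close>
  define I where "I \<Gamma> \<longleftrightarrow> valid_sequent \<Gamma> \<and> \<Gamma> \<noteq> {#F#} \<and> \<Gamma> \<noteq> {#Pos p, Z#} \<and>
    \<Gamma> \<noteq> {#Pos p, Pos q, Y#} \<and> \<Gamma> \<noteq> {#Pos p, Pos q, Neg p#}" for \<Gamma>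
  have I_eval: "\<exists>A \<in># \<Gamma>. eval v A" if "I \<Gamma>" for \<Gamma> v
    using that by (simp add: I_def valid_sequent_def)
  have eqs: "add_mset A \<Gamma> = \<Delta> \<longleftrightarrow> A \<in># \<Delta> \<and> \<Gamma> = \<Delta> - {#A#}" for A :: "'a form" and \<Gamma> \<Delta>
    by auto
  \<comment> \<open>The only compound formula of the sequent must be the principal one.\<close>
  have pair: "{#Pos p, C \<^bold>\<or> D#} = add_mset (A \<^bold>\<or> B) \<Gamma> \<longleftrightarrow> A = C \<and> B = D \<and> \<Gamma> = {#Pos p#}"
    "{#Pos p, C \<^bold>\<or> D#} \<noteq> add_mset (A \<^bold>\<and> B) \<Gamma>" "{#Pos p, C \<^bold>\<or> D#} \<noteq> {#Pos r, Neg r#}"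
    for A B C D :: "'a form" and \<Gamma> r
    by (auto simp: add_eq_conv_ex)
  have triple: "{#Pos p, Pos q, C \<^bold>\<and> D#} = add_mset (A \<^bold>\<and> B) \<Gamma> \<longleftrightarrow>
      A = C \<and> B = D \<and> \<Gamma> = {#Pos p, Pos q#}"
    "{#Pos p, Pos q, C \<^bold>\<and> D#} \<noteq> add_mset (A \<^bold>\<or> B) \<Gamma>" "{#Pos p, Pos q, C \<^bold>\<and> D#} \<noteq> {#Pos r, Neg r#}"
    for A B C D :: "'a form" and \<Gamma> r
    by (auto simp: add_eq_conv_ex)
  show ?thesis
  proof (rule not_completeI[OF _ S, where A = F and I = I])
    show "valid F"
      by (auto simp: valid_def F_def Z_def Y_def X_def)
    show "\<not> I {#F#}"
      by (simp add: I_def)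
  next
    fix R :: "'a rule" and ps \<Delta>
    assume R: "R \<in> {ax_rule, with_rule, tensor_rule, plus_rule, par_rule}" "(ps, \<Delta>) \<in> R"
      and ps: "\<forall>\<Gamma> \<in> set ps. I \<Gamma>"
    have ev: "\<forall>\<Gamma> \<in> set ps. \<exists>A \<in># \<Gamma>. eval v A" for v
      using ps I_eval by blast
    have "\<exists>A \<in># \<Delta>. eval v A" for v
      using R ev[of v] by (auto simp: rule_defs)
    then have "valid_sequent \<Delta>"
      by (simp add: valid_sequent_def)
    moreover have "\<Delta> \<noteq> {#F#}"
    proof
      assume "\<Delta> = {#F#}"
      then have "ps \<in> {[{#Pos p#}], [{#Z#}], [{#Pos p, Z#}]}"
        using R by (auto simp: rule_defs F_def eqs)
      then show False
        \<comment> \<open>The two assignments falsify \<open>Z\<close> and \<open>Pos p\<close>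
          respectively; the par premise is excluded by \<open>I\<close>.\<close>
        using ps ev[of "\<lambda>r. r = p"] ev[of "\<lambda>r. r = q"] assms(1)
        by (auto simp: Z_def Y_def X_def I_def)
    qed
    moreover have "\<Delta> \<noteq> {#Pos p, Z#}"
    proof
      assume "\<Delta> = {#Pos p, Z#}"
      then have "ps \<in> {[{#Pos p, Pos q#}], [{#Pos p, Y#}], [{#Pos p, Pos q, Y#}]}"
        using R by (auto simp: rule_defs Z_def pair
            add_mset_commute[of "Pos q" "Pos p"] add_mset_commute[of Y "Pos p"])
      then show False
        \<comment> \<open>The plus premises fail with all variables false and with only
          \<open>q\<close> true.\<close>
        using ps ev[of "\<lambda>r. False"] ev[of "\<lambda>r. r = q"] assms(1)
        by (auto simp: Y_def X_def I_def)
    qed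
    moreover have "\<Delta> \<noteq> {#Pos p, Pos q, Y#}"
    proof
      assume "\<Delta> = {#Pos p, Pos q, Y#}"
      then have "{#Neg p, Pos p, Pos q#} \<in> set ps \<or>
        (\<exists>\<Theta> \<Sigma>. \<Theta> + \<Sigma> = {#Pos p, Pos q#} \<and> ps = [add_mset X \<Theta>, add_mset (Neg p) \<Sigma>])"
        using R by (auto simp: rule_defs Y_def triple)
      then consider "{#Pos p, Pos q, Neg p#} \<in> set ps"
        | \<Theta> \<Sigma> where "\<Theta> + \<Sigma> = {#Pos p, Pos q#}" "ps = [add_mset X \<Theta>, add_mset (Neg p) \<Sigma>]"
        by (auto simp: add_mset_commute)
      then show False
      proof cases
        case 1
        then show False
          using ps by (auto simp: I_def)
      next
        case 2
        have sub: "set_mset \<Theta> \<subseteq> {Pos p, Pos q}" "set_mset \<Sigma> \<subseteq> {Pos p, Pos q}"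
          using arg_cong[OF 2(1), of set_mset] by auto
        \<comment> \<open>With only \<open>p\<close> true, neither active formula holds, so both
          tensor premises need the single \<open>Pos p\<close>.\<close>
        then have "Pos p \<in># \<Theta>" "Pos p \<in># \<Sigma>"
          using ev[of "\<lambda>r. r = p"] assms(1) by (auto simp: 2(2) X_def)
        then show False
          using arg_cong[OF 2(1), of "\<lambda>\<Gamma>. count \<Gamma> (Pos p)"] assms(1)
          by (simp flip: count_greater_zero_iff)
      qed
    qed
    moreover have "\<Delta> \<noteq> {#Pos p, Pos q, Neg p#}"
    proof
      \<comment> \<open>Only an axiom can conclude a sequent of literals here, and axioms have two
        formulas.\<close>
      assume "\<Delta> = {#Pos p, Pos q, Neg p#}"
      then show False
        using R by (auto simp: rule_defs eqs)
    qed
    ultimately show "I \<Delta>"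
      by (simp add: I_def)
  qed
qed

section \<open>From the seven constraints to the rules of \<open>Mp\<close>\<close>

section \<open>The characterization\<close>

theorem theorem9:
  fixes S :: "'a system"
  assumes "infinite (UNIV :: 'a set)"
    and "standard_system S"
  shows "complete_system S \<longleftrightarrow> contains_system S Mp"
proof
  assume "contains_system S Mp"
  then show "complete_system S"
    using complete_Mp derives_contains_system unfolding complete_system_def by blast
next
  assume complete: "complete_system S"
  obtain p q :: 'a where "p \<noteq> q"
    using assms(1) by (metis ex_new_if_finite finite.emptyI finite.insertI insertI1)
  have ax: "ax_rule \<in> S"
    and S: "S \<subseteq> {ax_rule, with_rule, tensor_rule, plus_rule, par_rule, weakening_rule, contraction_rule}"
    using assms(2) unfolding standard_system_def by blast+
  \<comment> \<open>Each maximal incomplete system omits two rules, so completeness forces one of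
    each such pair into \<open>S\<close>.\<close>
  have 1: "with_rule \<in> S \<or> tensor_rule \<in> S"
    by (rule ccontr, rule notE[OF incomplete_no_with_no_tensor complete]) (use S in blast)
  have 2: "with_rule \<in> S \<or> contraction_rule \<in> S"
    by (rule ccontr, rule notE[OF incomplete_no_with_no_contraction complete]) (use S in blast)
  have 3: "tensor_rule \<in> S \<or> weakening_rule \<in> S"
    by (rule ccontr, rule notE[OF incomplete_no_tensor_no_weakening complete]) (use S \<open>p \<noteq> q\<close> in blast)+
  have 4: "weakening_rule \<in> S \<or> contraction_rule \<in> S"
    by (rule ccontr, rule notE[OF incomplete_no_weakening_no_contraction complete]) (use S \<open>p \<noteq> q\<close> in blast)+
  have 5: "plus_rule \<in> S \<or> weakening_rule \<in> S"
    by (rule ccontr, rule notE[OF incomplete_no_plus_no_weakening complete]) (use S \<open>p \<noteq> q\<close> in blast)+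
  have 6: "plus_rule \<in> S \<or> par_rule \<in> S"
    by (rule ccontr, rule notE[OF incomplete_no_plus_no_par complete]) (use S in blast)
  have 7: "par_rule \<in> S \<or> contraction_rule \<in> S"
    by (rule ccontr, rule notE[OF incomplete_no_par_no_contraction complete]) (use S in blast)
  \<comment> \<open>The first four disjunctions amount to having \<open>with_rule\<close> and
    weakening, or tensor and contraction.\<close>
  have "derivable_rule S blended_rule"
    using 1 2 3 4 derivable_blended_with_weakening derivable_blended_tensor_contraction by blast
  moreover have "derivable_rule S plus_rule"
    using 5 6 derivable_rule_member derivable_plus_par_weakening by blast
  moreover have "derivable_rule S par_rule"
    using 6 7 derivable_rule_member derivable_par_plus_contraction by blast
  ultimately show "contains_system S Mp"
    using ax by (simp add: contains_system_def Mp_def derivable_rule_member)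
qed

end
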